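(* Let $\theta_0,\theta_\infty\in\mathbb{C}$ and let $q$ be a (not identically zero) meromorphic solution, on a connected open set $U\subset\mathbb{C}^*$, of the equation ${\rm PIII(D_6)}$ with parameters $(\theta_0,\theta_\infty)$: $$q''=\frac{(q')^2}{q}-\frac{q'}{t}-\frac{4(\theta_0-1)}{t}+\frac{4\theta_\infty q^2}{t}+4q^3-\frac4q.$$ Put $a=\frac{tq'+q}{4}$ and suppose that $tq^2+q\theta_\infty-t+2a$ is not identically zero. Then $$\tilde q=-\frac{tq^2-q\theta_0-t+2a}{q\,(tq^2+q\theta_\infty-t+2a)}$$ is a solution of ${\rm PIII(D_6)}$ with parameters $(1+\theta_0,1+\theta_\infty)$, i.e. $$\tilde q''=\frac{(\tilde q')^2}{\tilde q}-\frac{\tilde q'}{t}-\frac{4\theta_0}{t}+\frac{4(1+\theta_\infty)\tilde q^2}{t}+4\tilde q^3-\frac4{\tilde q}.$$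
   Context: Here $'=\frac{d}{dt}$, and solutions are understood as meromorphic functions satisfying the equation as an identity of meromorphic functions. *)

theory Defs
  imports "HOL-Complex_Analysis.Complex_Analysis"
begin

text \<open>
  A meromorphic function is represented by a total function, whose values on a discrete subset of
  \<open>U\<close> (poles, for instance) are irrelevant. Hence identities of meromorphic functions on \<open>U\<close> are
  equalities outside a subset of \<open>U\<close> without limit points in \<open>U\<close>, written \<open>\<forall>\<^sub>\<approx>t\<in>U\<close>.
\<close>

definition identically_zero_on :: "(complex \<Rightarrow> complex) \<Rightarrow> complex set \<Rightarrow> bool" where
  "identically_zero_on f U \<longleftrightarrow> (\<forall>\<^sub>\<approx>t\<in>U. f t = 0)"

text \<open>
  Since \<open>q\<close> occurs in denominators and division is total, a solution is explicitly required
  not to be the zero function.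
\<close>

definition PIII_D6_solution ::
    "complex \<Rightarrow> complex \<Rightarrow> complex set \<Rightarrow> (complex \<Rightarrow> complex) \<Rightarrow> bool" where
  "PIII_D6_solution \<theta>0 \<theta>inf U q \<longleftrightarrow>
     q meromorphic_on U \<and> \<not> identically_zero_on q U \<and>
     (\<forall>\<^sub>\<approx>t\<in>U. deriv (deriv q) t =
        (deriv q t)^2 / q t - deriv q t / t - 4 * (\<theta>0 - 1) / t
        + 4 * \<theta>inf * (q t)^2 / t + 4 * (q t)^3 - 4 / q t)"

end

theory Submission
  imports Defs
begin

text \<open>
  Put \<open>v = (t q\<^sup>2 - t + 2 a) / q\<close>. In terms of \<open>q\<close> and \<open>v\<close> the equation becomes the first-order system
  \<open>t q' = 2 v q - 2 t q\<^sup>2 + 2 t - q\<close>, \<open>v' = 2 (v - \<theta>0) / q + 2 (v + \<theta>inf) q\<close>, and the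
  transformation reads \<open>Q = - (v - \<theta>0) / (q (v + \<theta>inf))\<close>. Eliminating \<open>q\<close> in favour of \<open>Q\<close> gives a
  system of the same shape, \<open>t Q' = 2 t Q\<^sup>2 - 2 t - 2 v Q + Q\<close>,
  \<open>v' = - 2 (v - \<theta>0) / Q - 2 (v + \<theta>inf) Q\<close>, and eliminating \<open>v\<close> from it gives the equation with
  shifted parameters. If \<open>Q\<close> vanished identically, \<open>v\<close> would be the constant \<open>\<theta>0\<close>, the equation for
  \<open>v'\<close> would give \<open>\<theta>0 + \<theta>inf = 0\<close>, and the denominator of \<open>Q\<close> would vanish identically.
\<close>

text \<open>The exceptional set has no limit point in \<open>A\<close>, so each other point of
  \<open>A\<close> has a neighbourhood avoiding it. An identity off a discrete set can thus be
  differentiated.\<close>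

lemma eventually_cosparse_nhds:
  fixes A :: "'a :: t1_space set"
  assumes "open A" "\<forall>\<^sub>\<approx>t\<in>A. P t"
  shows "\<forall>\<^sub>\<approx>t\<in>A. eventually P (nhds t)"
  unfolding eventually_cosparse_open_eq[OF assms(1)]
proof
  fix x assume "x \<in> A"
  with assms have "eventually P (at x)"
    by (simp add: eventually_cosparse_open_eq)
  then obtain S where S: "open S" "x \<in> S" "\<And>y. y \<in> S \<Longrightarrow> y \<noteq> x \<Longrightarrow> P y"
    by (auto simp: eventually_at_topological)
  have "eventually P (nhds y)" if "y \<in> S" "y \<noteq> x" for y
    unfolding eventually_nhds
    by (rule exI[of _ "S - {x}"]) (use S that in auto)
  with S(1,2) show "\<forall>\<^sub>F y in at x. eventually P (nhds y)"
    unfolding eventually_at_topological by blast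
qed

text \<open>This is the identity theorem; connectedness of \<open>U\<close> enters here.\<close>

lemma meromorphic_not_identically_zero_on:
  assumes "f meromorphic_on U" "open U" "connected U" "\<not> identically_zero_on f U"
  shows "\<forall>\<^sub>\<approx>t\<in>U. f t \<noteq> 0"
  using meromorphic_imp_constant_or_avoid[OF assms(1-3), of 0] assms(4)
  unfolding identically_zero_on_def by blast

text \<open>Where \<open>q\<close> is nonzero, this is the \<open>v\<close> of the overview with
  \<open>a\<close> written out.\<close>

definition companion :: "(complex \<Rightarrow> complex) \<Rightarrow> complex \<Rightarrow> complex" where
  "companion q t = t * q t - t / q t + t * deriv q t / (2 * q t) + 1 / 2"

text \<open>Inserting the equation into \<open>t q'' / (2 q)\<close> yields
  \<open>t q'^2 / (2 q^2) - q' / (2 q)\<close>, which cancels against the other derivatives; the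
  rest is affine in \<open>q'\<close> and regroups through \<open>v\<close>.\<close>

lemma companion_has_field_derivative:
  assumes "q analytic_on {t}" "q t \<noteq> 0" "t \<noteq> 0"
    and ode: "deriv (deriv q) t =
        (deriv q t)^2 / q t - deriv q t / t - 4 * (T - 1) / t
        + 4 * S * (q t)^2 / t + 4 * (q t)^3 - 4 / q t"
  shows "(companion q has_field_derivative
           2 * (companion q t - T) / q t + 2 * (companion q t + S) * q t) (at t)"
proof -
  have q: "(q has_field_derivative deriv q t) (at t)"
    using assms(1) by (simp add: analytic_derivI)
  have q': "(deriv q has_field_derivative deriv (deriv q) t) (at t)"
    using analytic_deriv[OF assms(1)] by (simp add: analytic_derivI)
  have "2 * q t \<noteq> 0" using assms by simp
  show ?thesis
    unfolding companion_def
    by (rule derivative_eq_intros q q' refl | fact)+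
       (use assms(2,3) in \<open>simp add: ode field_simps power2_eq_square power3_eq_cube\<close>)
qed

text \<open>Formally \<open>Q'/Q = v'/(v - T) - v'/(v + S) - q'/q\<close>. The first two terms give
  \<open>2/q - 2 q + 2 Q - 2/Q\<close>, and \<open>q'/q\<close> removes \<open>2/q - 2 q\<close>.
  Using the quotient rule instead allows zeros of \<open>Q\<close>.\<close>

lemma transformed_has_field_derivative:
  fixes q v Q :: "complex \<Rightarrow> complex" and T S t q' :: complex
  assumes q: "(q has_field_derivative q') (at t)"
    and q': "t * q' = 2 * v t * q t - 2 * t * (q t)^2 + 2 * t - q t"
    and v: "(v has_field_derivative 2 * (v t - T) / q t + 2 * (v t + S) * q t) (at t)"
    and Q: "\<forall>\<^sub>F s in nhds t. Q s = - ((v s - T) / (q s * (v s + S)))"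
    and nz: "t \<noteq> 0" "q t \<noteq> 0" "v t + S \<noteq> 0"
  shows "(Q has_field_derivative 2 * (Q t)^2 - 2 - (2 * v t - 1) * Q t / t) (at t)"
proof -
  have Qt: "Q t = - ((v t - T) / (q t * (v t + S)))"
    using Q by (rule eventually_nhds_x_imp_x)
  have q'': "q' = (2 * v t * q t - 2 * t * (q t)^2 + 2 * t - q t) / t"
    using q' nz by (simp add: field_simps)
  have den: "q t * (v t + S) \<noteq> 0" using nz by simp
  \<comment> \<open>With \<open>v t = D - S\<close> all denominators are products of nonzero atoms,
    leaving a polynomial identity.\<close>
  define D where "D = v t + S"
  have vt: "v t = D - S" by (simp add: D_def)
  have "D \<noteq> 0" using nz by (simp add: D_def)
  have "((\<lambda>s. - ((v s - T) / (q s * (v s + S)))) has_field_derivative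
          2 * (Q t)^2 - 2 - (2 * v t - 1) * Q t / t) (at t)"
    apply (rule derivative_eq_intros q v refl den)+
    unfolding Qt q'' vt
    using nz(1,2) \<open>D \<noteq> 0\<close> by (simp add: divide_simps) algebra
  thus ?thesis
    using Q by (subst DERIV_cong_ev[OF refl _ refl]) auto
qed

text \<open>Differentiate the first-order equation for \<open>Q\<close>, insert \<open>v'\<close>,
  then solve that same equation for \<open>v\<close>. The leftover terms
  \<open>2 (Q^2 - 1)/t\<close> and \<open>2 (Q^2 + 1)/t\<close> add up to \<open>4 Q^2/t\<close>,
  which produces the parameter shift.\<close>

lemma transformed_second_derivative:
  fixes v Q :: "complex \<Rightarrow> complex" and T S t :: complex
  assumes Q: "\<forall>\<^sub>F s in nhds t.
      (Q has_field_derivative 2 * (Q s)^2 - 2 - (2 * v s - 1) * Q s / s) (at s)"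
    and v: "(v has_field_derivative - 2 * (v t - T) / Q t - 2 * (v t + S) * Q t) (at t)"
    and nz: "t \<noteq> 0" "Q t \<noteq> 0"
  shows "deriv (deriv Q) t =
        (deriv Q t)^2 / Q t - deriv Q t / t - 4 * T / t
        + 4 * (1 + S) * (Q t)^2 / t + 4 * (Q t)^3 - 4 / Q t"
proof -
  have Q1: "(Q has_field_derivative 2 * (Q t)^2 - 2 - (2 * v t - 1) * Q t / t) (at t)"
    using Q by (rule eventually_nhds_x_imp_x)
  have Q': "deriv Q t = 2 * (Q t)^2 - 2 - (2 * v t - 1) * Q t / t"
    using Q1 by (rule DERIV_imp_deriv)
  have "\<forall>\<^sub>F s in nhds t. deriv Q s = 2 * (Q s)^2 - 2 - (2 * v s - 1) * Q s / s"
    using Q by eventually_elim (rule DERIV_imp_deriv)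
  hence "deriv (deriv Q) t = deriv (\<lambda>s. 2 * (Q s)^2 - 2 - (2 * v s - 1) * Q s / s) t"
    by (rule deriv_cong_ev) simp
  also have "\<dots> = (deriv Q t)^2 / Q t - deriv Q t / t - 4 * T / t
        + 4 * (1 + S) * (Q t)^2 / t + 4 * (Q t)^3 - 4 / Q t"
    apply (rule DERIV_imp_deriv)
    apply (rule derivative_eq_intros Q1 v refl nz)+
    unfolding Q'
    using nz by (simp add: divide_simps) algebra
  finally show ?thesis .
qed

theorem mainTheorem7:
  fixes \<theta>0 \<theta>inf :: complex and U :: "complex set" and q a qt :: "complex \<Rightarrow> complex"
  assumes "open U" and "connected U" and "0 \<notin> U"
    and "PIII_D6_solution \<theta>0 \<theta>inf U q"
    and "a = (\<lambda>t. (t * deriv q t + q t) / 4)"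
    and "\<not> identically_zero_on (\<lambda>t. t * (q t)^2 + q t * \<theta>inf - t + 2 * a t) U"
    and "qt = (\<lambda>t. - ((t * (q t)^2 - q t * \<theta>0 - t + 2 * a t)
                     / (q t * (t * (q t)^2 + q t * \<theta>inf - t + 2 * a t))))"
  shows "PIII_D6_solution (1 + \<theta>0) (1 + \<theta>inf) U qt"
proof -
  define v where "v = companion q"
  define D where "D = (\<lambda>t. t * (q t)^2 + q t * \<theta>inf - t + 2 * a t)"
  have mero_q: "q meromorphic_on U" and q_nz: "\<not> identically_zero_on q U"
    and ode: "\<forall>\<^sub>\<approx>t\<in>U. deriv (deriv q) t =
        (deriv q t)^2 / q t - deriv q t / t - 4 * (\<theta>0 - 1) / t
        + 4 * \<theta>inf * (q t)^2 / t + 4 * (q t)^3 - 4 / q t"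
    using assms(4) by (auto simp: PIII_D6_solution_def)
  have mero_a: "a meromorphic_on U"
    unfolding assms(5) by (intro meromorphic_intros mero_q)
  have mero_D: "D meromorphic_on U"
    unfolding D_def by (intro meromorphic_intros mero_q mero_a)
  have mero_qt: "qt meromorphic_on U"
    unfolding assms(7) by (intro meromorphic_intros mero_q mero_a)
  have ev_t: "\<forall>\<^sub>\<approx>t\<in>U. t \<noteq> 0"
    using eventually_in_cosparse[OF order.refl assms(1)]
    by eventually_elim (use assms(3) in auto)
  have ev_q: "\<forall>\<^sub>\<approx>t\<in>U. q t \<noteq> 0"
    by (rule meromorphic_not_identically_zero_on[OF mero_q assms(1,2) q_nz])
  have ev_D: "\<forall>\<^sub>\<approx>t\<in>U. D t \<noteq> 0"
    using meromorphic_not_identically_zero_on[OF mero_D assms(1,2)] assms(6) by (simp add: D_def)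
  have D_eq: "D t = q t * (v t + \<theta>inf)" if "q t \<noteq> 0" for t
    using that unfolding D_def assms(5) v_def companion_def
    by (simp add: field_simps power2_eq_square)
  have qt_eq: "qt t = - ((v t - \<theta>0) / (q t * (v t + \<theta>inf)))" if "q t \<noteq> 0" for t
  proof -
    have N: "t * (q t)^2 - q t * \<theta>0 - t + 2 * a t = q t * (v t - \<theta>0)"
      using that unfolding assms(5) v_def companion_def
      by (simp add: field_simps power2_eq_square)
    show ?thesis
      using D_eq[OF that] that unfolding assms(7) N D_def by simp
  qed
  have good: "\<forall>\<^sub>\<approx>t\<in>U. t \<noteq> 0 \<and> q t \<noteq> 0 \<and> v t + \<theta>inf \<noteq> 0 \<and>
     (v has_field_derivative 2 * (v t - \<theta>0) / q t + 2 * (v t + \<theta>inf) * q t) (at t) \<and>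
     (qt has_field_derivative 2 * (qt t)^2 - 2 - (2 * v t - 1) * qt t / t) (at t)"
    using ev_t ev_q ev_D ode meromorphic_on_imp_analytic_cosparse[OF mero_q]
      eventually_cosparse_nhds[OF assms(1) ev_q]
  proof eventually_elim
    case (elim t)
    have v: "(v has_field_derivative 2 * (v t - \<theta>0) / q t + 2 * (v t + \<theta>inf) * q t) (at t)"
      unfolding v_def by (rule companion_has_field_derivative) (use elim in auto)
    have q': "t * deriv q t = 2 * v t * q t - 2 * t * (q t)^2 + 2 * t - q t"
      using elim(1,2) unfolding v_def companion_def by (simp add: field_simps power2_eq_square)
    have nz: "v t + \<theta>inf \<noteq> 0" using elim D_eq by auto
    have ev: "\<forall>\<^sub>F s in nhds t. qt s = - ((v s - \<theta>0) / (q s * (v s + \<theta>inf)))"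
      using elim(6) by eventually_elim (rule qt_eq)
    have "(q has_field_derivative deriv q t) (at t)"
      using elim(5) by (simp add: analytic_derivI)
    from transformed_has_field_derivative[OF this q' v ev elim(1,2) nz] v nz elim show ?case
      by blast
  qed
  have qt_nz: "\<not> identically_zero_on qt U"
  proof
    assume "identically_zero_on qt U"
    hence zero: "\<forall>\<^sub>\<approx>t\<in>U. qt t = 0" by (simp add: identically_zero_on_def)
    have v_eq: "\<forall>\<^sub>\<approx>t\<in>U. v t = \<theta>0"
      using zero good by eventually_elim (use qt_eq in auto)
    have "\<forall>\<^sub>\<approx>t\<in>U. False"
      using good v_eq eventually_cosparse_nhds[OF assms(1) v_eq]
    proof eventually_elim
      case (elim t)
      have "(v has_field_derivative 0) (at t)"
        using elim(3) by (subst DERIV_cong_ev[OF refl _ refl]) auto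
      with elim(1) have "2 * (v t - \<theta>0) / q t + 2 * (v t + \<theta>inf) * q t = 0"
        using DERIV_unique by blast
      hence "2 * ((v t + \<theta>inf) * q t) = 0"
        using elim(2) by (simp only: mult.assoc diff_self mult_zero_right div_0 add_0_left)
      with elim(1) show ?case by simp
    qed
    \<comment> \<open>Only an empty \<open>U\<close> is left, where \<open>q\<close> vanishes
      vacuously.\<close>
    hence "identically_zero_on q U"
      unfolding identically_zero_on_def by eventually_elim simp
    with q_nz show False ..
  qed
  have ev_qt: "\<forall>\<^sub>\<approx>t\<in>U. qt t \<noteq> 0"
    by (rule meromorphic_not_identically_zero_on[OF mero_qt assms(1,2) qt_nz])
  have "\<forall>\<^sub>\<approx>t\<in>U. deriv (deriv qt) t =
        (deriv qt t)^2 / qt t - deriv qt t / t - 4 * \<theta>0 / t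
        + 4 * (1 + \<theta>inf) * (qt t)^2 / t + 4 * (qt t)^3 - 4 / qt t"
    using good eventually_cosparse_nhds[OF assms(1) good] ev_qt
  proof eventually_elim
    case (elim t)
    have ev: "\<forall>\<^sub>F s in nhds t.
        (qt has_field_derivative 2 * (qt s)^2 - 2 - (2 * v s - 1) * qt s / s) (at s)"
      using elim(2) by eventually_elim blast
    have nz: "q t \<noteq> 0" "qt t \<noteq> 0" using elim by auto
    \<comment> \<open>Hence \<open>(v - \<theta>0) / q = - (v + \<theta>inf) Q\<close> and
      \<open>(v + \<theta>inf) q = - (v - \<theta>0) / Q\<close>: the two terms of \<open>v'\<close>
      swap roles.\<close>
    have v_diff: "v t - \<theta>0 = - (q t * (v t + \<theta>inf) * qt t)"
      using elim qt_eq[of t] by simp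
    have "2 * (v t - \<theta>0) / q t + 2 * (v t + \<theta>inf) * q t
        = - 2 * (v t - \<theta>0) / qt t - 2 * (v t + \<theta>inf) * qt t"
      unfolding v_diff using nz by (simp add: divide_simps) algebra
    with elim(1) have "(v has_field_derivative
        - 2 * (v t - \<theta>0) / qt t - 2 * (v t + \<theta>inf) * qt t) (at t)"
      by metis
    from transformed_second_derivative[OF ev this] elim show ?case by blast
  qed
  with mero_qt qt_nz show ?thesis
    by (simp add: PIII_D6_solution_def)
qed

end
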